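(* For every integer $n\ge 0$ there exist finite sets $\mathcal Y,\mathcal X$, a strongly connected digraph $(\mathcal Y,\mathcal E)$ and a surjective map $\kappa\colon\mathcal Y\to\mathcal X$ with $1<|\mathcal X|<|\mathcal Y|$ such that $\mathcal W_\kappa(\mathcal Y,\mathcal E)$ is non-empty, forms an e-family, and $(\mathcal Y,\mathcal E)$ has exactly $n$ multi-row merging blocks with respect to $\kappa$.
   Context: For a finite set $\mathcal Y$ and a nonempty edge set $\mathcal E\subset\mathcal Y^2$ such that the digraph $(\mathcal Y,\mathcal E)$ is strongly connected: $\mathcal F(\mathcal Y,\mathcal E)=\mathbb R^{\mathcal E}$ is the space of real functions on $\mathcal E$, identified with real $\mathcal Y\times\mathcal Y$ matrices vanishing outside $\mathcal E$; $\mathcal F^+(\mathcal Y,\mathcal E)$ is the subset of those that are strictly positive on $\mathcal E$; $\mathcal W(\mathcal Y,\mathcal E)\subset\mathcal F^+(\mathcal Y,\mathcal E)$ is the set of row-stochastic ones. For $\kappa\colon\mathcal Y\to\mathcal X$ surjective, $\mathcal S_x=\kappa^{-1}(x)$, $\mathcal D=\{(\kappa(y),\kappa(y')):(y,y')\in\mathcal E\}$, and $F(y,\mathcal S_{x'})=\sum_{y'\in\mathcal S_{x'}}F(y,y')$. $\mathcal W_\kappa(\mathcal Y,\mathcal E)$ is the set of $\kappa$-lumpable $P\in\mathcal W(\mathcal Y,\mathcal E)$, i.e. those with $P(y_1,\mathcal S_{x'})=P(y_2,\mathcal S_{x'})$ for all $(x,x')\in\mathcal D$ and $y_1,y_2\in\mathcal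 S_x$. Merging blocks: $(x,x')\in\mathcal D$ is a merging block of $(\mathcal Y,\mathcal E)$ with respect to $\kappa$ if for some $y\in\mathcal S_x$ one has $|\{(y,y')\in\mathcal E: y'\in\mathcal S_{x'}\}|>1$; it is multi-row if moreover $|\mathcal S_x|\ge 2$. E-families: for $F\in\mathcal F^+(\mathcal Y,\mathcal E)$ with Perron–Frobenius root $\rho_F$ and positive right eigenvector $v_F$, put $\mathfrak s(F)(y,y')=\frac{F(y,y')v_F(y')}{\rho_F v_F(y)}$, so $\mathfrak s(F)\in\mathcal W(\mathcal Y,\mathcal E)$. Let $\mathcal N(\mathcal Y,\mathcal E)$ be the linear space of $N\in\mathcal F(\mathcal Y,\mathcal E)$ of the form $N(y,y')=f(y')-f(y)+c$ with $f\in\mathbb R^{\mathcal Y}$, $c\in\mathbb R$. A set $\mathcal V\subset\mathcal W(\mathcal Y,\mathcal E)$ forms an e-family (of dimension $d\ge 0$) if there are $K\in\mathcal F(\mathcal Y,\mathcal E)$ and $G_1,\dots,G_d\in\mathcal F(\mathcal Y,\mathcal E)$, linearly independent modulo $\mathcal N(\mathcal Y,\mathcal E)$, with $\mathcal V=\{\mathfrak s(\exp(K+\sum_{i=1}^d\theta^iG_i)):\theta\in\mathbb R^d\}$, where $\exp$ is applied entrywise on $\mathcal E$. *)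

theory Defs
  imports Complex_Main
begin

text \<open>
  A real \<open>\<Y> \<times> \<Y>\<close> matrix is a curried function \<open>'a \<Rightarrow> 'a \<Rightarrow> real\<close>. Members of \<open>fun_space E\<close> vanish
  at every pair outside \<open>E \<subseteq> Y \<times> Y\<close>, so HOL equality of two such functions is equality
  of the corresponding elements of \<open>\<real>\<^sup>E\<close>.
\<close>

type_synonym 'a matrix = "'a \<Rightarrow> 'a \<Rightarrow> real"

definition strongly_connected_digraph :: "'a set \<Rightarrow> ('a \<times> 'a) set \<Rightarrow> bool" where
  "strongly_connected_digraph Y E \<longleftrightarrow>
     finite Y \<and> E \<subseteq> Y \<times> Y \<and> E \<noteq> {} \<and> (\<forall>y\<in>Y. \<forall>y'\<in>Y. (y, y') \<in> E\<^sup>*)"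

definition fun_space :: "('a \<times> 'a) set \<Rightarrow> 'a matrix set" where
  "fun_space E = {F. \<forall>y y'. (y, y') \<notin> E \<longrightarrow> F y y' = 0}"

definition pos_fun_space :: "('a \<times> 'a) set \<Rightarrow> 'a matrix set" where
  "pos_fun_space E = {F \<in> fun_space E. \<forall>(y, y')\<in>E. 0 < F y y'}"

definition stochastic_matrices :: "'a set \<Rightarrow> ('a \<times> 'a) set \<Rightarrow> 'a matrix set" where
  "stochastic_matrices Y E = {P \<in> pos_fun_space E. \<forall>y\<in>Y. (\<Sum>y'\<in>Y. P y y') = 1}"


subsection \<open>Lumpability and merging blocks\<close>

definition fiber :: "'a set \<Rightarrow> ('a \<Rightarrow> 'b) \<Rightarrow> 'b \<Rightarrow> 'a set" where
  "fiber Y \<kappa> x = {y \<in> Y. \<kappa> y = x}"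

definition lumped_edges :: "('a \<times> 'a) set \<Rightarrow> ('a \<Rightarrow> 'b) \<Rightarrow> ('b \<times> 'b) set" where
  "lumped_edges E \<kappa> = {(\<kappa> y, \<kappa> y') | y y'. (y, y') \<in> E}"

definition lumpable_matrices ::
  "'a set \<Rightarrow> ('a \<times> 'a) set \<Rightarrow> ('a \<Rightarrow> 'b) \<Rightarrow> 'a matrix set" where
  "lumpable_matrices Y E \<kappa> =
     {P \<in> stochastic_matrices Y E.
        \<forall>(x, x')\<in>lumped_edges E \<kappa>. \<forall>y1\<in>fiber Y \<kappa> x. \<forall>y2\<in>fiber Y \<kappa> x.
          (\<Sum>y'\<in>fiber Y \<kappa> x'. P y1 y') = (\<Sum>y'\<in>fiber Y \<kappa> x'. P y2 y')}"

definition merging_block ::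
  "'a set \<Rightarrow> ('a \<times> 'a) set \<Rightarrow> ('a \<Rightarrow> 'b) \<Rightarrow> 'b \<times> 'b \<Rightarrow> bool" where
  "merging_block Y E \<kappa> = (\<lambda>(x, x').
     (x, x') \<in> lumped_edges E \<kappa> \<and>
     (\<exists>y\<in>fiber Y \<kappa> x. 1 < card {(z, y') \<in> E. z = y \<and> y' \<in> fiber Y \<kappa> x'}))"

definition multi_row_merging_block ::
  "'a set \<Rightarrow> ('a \<times> 'a) set \<Rightarrow> ('a \<Rightarrow> 'b) \<Rightarrow> 'b \<times> 'b \<Rightarrow> bool" where
  "multi_row_merging_block Y E \<kappa> b \<longleftrightarrow>
     merging_block Y E \<kappa> b \<and> 2 \<le> card (fiber Y \<kappa> (fst b))"


subsection \<open>Stochastic rescaling and e-families\<close>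

definition eigenvalues_on :: "'a set \<Rightarrow> 'a matrix \<Rightarrow> complex set" where
  "eigenvalues_on Y F =
     {\<mu>. \<exists>u. (\<exists>y\<in>Y. u y \<noteq> 0) \<and> (\<forall>y\<in>Y. (\<Sum>y'\<in>Y. of_real (F y y') * u y') = \<mu> * u y)}"

text \<open>The Perron--Frobenius root of a nonnegative irreducible matrix is its spectral radius.\<close>

definition pf_root :: "'a set \<Rightarrow> 'a matrix \<Rightarrow> real" where
  "pf_root Y F = (SUP \<mu>\<in>eigenvalues_on Y F. cmod \<mu>)"

definition is_pf_vector :: "'a set \<Rightarrow> 'a matrix \<Rightarrow> ('a \<Rightarrow> real) \<Rightarrow> bool" where
  "is_pf_vector Y F v \<longleftrightarrow>
     (\<forall>y\<in>Y. 0 < v y) \<and> (\<forall>y\<in>Y. (\<Sum>y'\<in>Y. F y y' * v y') = pf_root Y F * v y)"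

text \<open>
  The positive eigenvector exists, and is unique up to a positive factor, by the Perron--Frobenius
  theorem; that factor cancels in \<open>stoch_rescale\<close>, so the choice below is immaterial.
\<close>

definition pf_vector :: "'a set \<Rightarrow> 'a matrix \<Rightarrow> 'a \<Rightarrow> real" where
  "pf_vector Y F = (SOME v. is_pf_vector Y F v)"

definition stoch_rescale :: "'a set \<Rightarrow> 'a matrix \<Rightarrow> 'a matrix" where
  "stoch_rescale Y F =
     (\<lambda>y y'. F y y' * pf_vector Y F y' / (pf_root Y F * pf_vector Y F y))"

definition exp_on :: "('a \<times> 'a) set \<Rightarrow> 'a matrix \<Rightarrow> 'a matrix" where
  "exp_on E F = (\<lambda>y y'. if (y, y') \<in> E then exp (F y y') else 0)"

definition null_space :: "('a \<times> 'a) set \<Rightarrow> 'a matrix set" where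
  "null_space E =
     {N \<in> fun_space E. \<exists>f :: 'a \<Rightarrow> real. \<exists>c. \<forall>(y, y')\<in>E. N y y' = f y' - f y + c}"

definition indep_mod_null :: "('a \<times> 'a) set \<Rightarrow> nat \<Rightarrow> (nat \<Rightarrow> 'a matrix) \<Rightarrow> bool" where
  "indep_mod_null E d G \<longleftrightarrow>
     (\<forall>a :: nat \<Rightarrow> real.
        (\<lambda>y y'. \<Sum>i<d. a i * G i y y') \<in> null_space E \<longrightarrow> (\<forall>i<d. a i = 0))"

definition e_family_of_dim ::
  "'a set \<Rightarrow> ('a \<times> 'a) set \<Rightarrow> nat \<Rightarrow> 'a matrix set \<Rightarrow> bool" where
  "e_family_of_dim Y E d V \<longleftrightarrow>
     V \<subseteq> stochastic_matrices Y E \<and>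
     (\<exists>K\<in>fun_space E. \<exists>G. (\<forall>i<d. G i \<in> fun_space E) \<and> indep_mod_null E d G \<and>
        V = {stoch_rescale Y (exp_on E (\<lambda>y y'. K y y' + (\<Sum>i<d. \<theta> i * G i y y')))
             | \<theta> :: nat \<Rightarrow> real. True})"

definition forms_e_family :: "'a set \<Rightarrow> ('a \<times> 'a) set \<Rightarrow> 'a matrix set \<Rightarrow> bool" where
  "forms_e_family Y E V \<longleftrightarrow> (\<exists>d. e_family_of_dim Y E d V)"

end

theory Submission
  imports Defs
begin

text \<open>
  If the lumped digraph is a directed cycle, then in every row all the mass goes to a single fibre,
  so each lumping condition reads \<open>1 = 1\<close> and all stochastic matrices are lumpable
  (\<open>lumpable_if_lumped_edges_single_valued\<close>). The set of all stochastic matrices is an e-family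
  whatever the size of the fibres (\<open>stochastic_matrices_e_family\<close>), so the fibres can be chosen to
  produce any number of multi-row merging blocks. With one fibre of size 1 followed by \<open>n + 1\<close>
  fibres of size 2, and all edges from each fibre to the next around the cycle, these blocks are the
  \<open>n\<close> pairs of consecutive fibres of size 2: the block out of the small fibre has one row, and the
  block into it has one column.

  That the stochastic matrices form an e-family comes down to linear algebra on logarithms.
  Rescaling forgets exactly the component of \<open>ln F\<close> in the null space, so the generators must span
  a complement of the null space; indicators of suitably chosen edges do
  (\<open>null_space_coordinate_complement\<close>). For the family to stay within the stochastic matrices, every
  positive function on the edges must have a positive eigenvector. Here the Perron--Frobenius
  theorem can be replaced by a formula: the fibre of size 1 is a vertex that all cycles visit with
  the same period, and the weights of the walks that lead to it give the eigenvector
  (\<open>cyclic_layers_positive_eigenpair\<close>).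
\<close>

section \<open>Perron--Frobenius eigenpairs\<close>

lemma strongly_connected_out_edge:
  assumes "strongly_connected_digraph Y E" "y \<in> Y"
  obtains y' where "(y, y') \<in> E"
proof -
  obtain a b where ab: "(a, b) \<in> E" "a \<in> Y"
    using assms(1) unfolding strongly_connected_digraph_def by fast
  then have "(y, a) \<in> E\<^sup>*"
    using assms unfolding strongly_connected_digraph_def by blast
  then show thesis
    using ab(1) that by (cases rule: converse_rtranclE) auto
qed

lemma strongly_connected_closed_subset:
  assumes sc: "strongly_connected_digraph Y E"
    and "z \<in> Z" "z \<in> Y" and step: "\<And>y y'. y \<in> Z \<Longrightarrow> (y, y') \<in> E \<Longrightarrow> y' \<in> Z"
  shows "Y \<subseteq> Z"
proof
  fix y assume "y \<in> Y"
  then have "(z, y) \<in> E\<^sup>*"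
    using sc \<open>z \<in> Y\<close> unfolding strongly_connected_digraph_def by blast
  then show "y \<in> Z"
    by induction (use \<open>z \<in> Z\<close> step in auto)
qed

lemma pos_fun_space_nonneg:
  assumes "F \<in> pos_fun_space E"
  shows "0 \<le> F y y'"
proof (cases "(y, y') \<in> E")
  case True
  then show ?thesis using assms by (force simp: pos_fun_space_def)
next
  case False
  then show ?thesis using assms by (simp add: pos_fun_space_def fun_space_def)
qed

text \<open>
  A positive eigenvector \<open>v\<close> dominates the rest of the spectrum: if \<open>u\<close> is an eigenvector for \<open>\<mu>\<close>,
  the row of \<open>\<mu> u = F u\<close> at a vertex where \<open>\<bar>u\<bar> / v\<close> is maximal yields \<open>\<bar>\<mu>\<bar> \<le> \<rho>\<close>.
\<close>

lemma pf_root_eqI: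
  assumes fin: "finite Y" and ne: "Y \<noteq> {}"
    and nonneg: "\<And>y y'. 0 \<le> F y y'"
    and v: "\<And>y. y \<in> Y \<Longrightarrow> 0 < v y"
    and eig: "\<And>y. y \<in> Y \<Longrightarrow> (\<Sum>y'\<in>Y. F y y' * v y') = \<rho> * v y"
  shows "pf_root Y F = \<rho>"
proof -
  have rho: "0 \<le> \<rho>"
  proof -
    obtain y where y: "y \<in> Y" using ne by auto
    have "0 \<le> (\<Sum>y'\<in>Y. F y y' * v y')"
      using nonneg v by (intro sum_nonneg mult_nonneg_nonneg) (auto intro: less_imp_le)
    then show ?thesis
      using eig[OF y] v[OF y] by (simp add: zero_le_mult_iff)
  qed
  have "complex_of_real \<rho> \<in> eigenvalues_on Y F"
    unfolding eigenvalues_on_def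
  proof (intro CollectI exI[of _ "\<lambda>y. complex_of_real (v y)"] conjI ballI)
    show "\<exists>y\<in>Y. complex_of_real (v y) \<noteq> 0" using ne v by fastforce
    show "(\<Sum>y'\<in>Y. complex_of_real (F y y') * complex_of_real (v y'))
            = complex_of_real \<rho> * complex_of_real (v y)" if "y \<in> Y" for y
      using arg_cong[OF eig[OF that], of complex_of_real] by simp
  qed
  then have mem: "\<rho> \<in> cmod ` eigenvalues_on Y F"
    using rho by (force simp: image_iff)
  have bound: "cmod \<mu> \<le> \<rho>" if \<mu>: "\<mu> \<in> eigenvalues_on Y F" for \<mu>
  proof -
    obtain u where u0: "\<exists>y\<in>Y. u y \<noteq> 0"
      and u: "\<And>y. y \<in> Y \<Longrightarrow> (\<Sum>y'\<in>Y. of_real (F y y') * u y') = \<mu> * u y"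
      using \<mu> unfolding eigenvalues_on_def by blast
    let ?r = "\<lambda>y. cmod (u y) / v y"
    obtain z where z: "z \<in> Y" and max: "\<And>y. y \<in> Y \<Longrightarrow> ?r y \<le> ?r z"
      using ex_is_arg_min_if_finite[OF fin ne, of "\<lambda>y. - ?r y"]
      by (auto simp: is_arg_min_linorder)
    have le: "cmod (u y) \<le> ?r z * v y" if "y \<in> Y" for y
      using max[OF that] v[OF that] by (simp add: pos_divide_le_eq)
    have pos: "0 < ?r z"
    proof -
      obtain y where "y \<in> Y" "u y \<noteq> 0" using u0 by blast
      then have "0 < ?r y" using v by simp
      then show ?thesis using max[OF \<open>y \<in> Y\<close>] by linarith
    qed
    have "cmod \<mu> * cmod (u z) = cmod (\<Sum>y'\<in>Y. of_real (F z y') * u y')"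
      using u[OF z] by (simp add: norm_mult)
    also have "\<dots> \<le> (\<Sum>y'\<in>Y. F z y' * cmod (u y'))"
      by (rule order_trans[OF norm_sum]) (simp add: norm_mult nonneg)
    also have "\<dots> \<le> (\<Sum>y'\<in>Y. F z y' * (?r z * v y'))"
      using le nonneg by (intro sum_mono mult_left_mono)
    also have "\<dots> = ?r z * (\<Sum>y'\<in>Y. F z y' * v y')"
      by (simp add: sum_distrib_left mult_ac)
    also have "\<dots> = \<rho> * cmod (u z)"
      using eig[OF z] v[OF z] by simp
    finally show ?thesis
      using pos v[OF z] by (simp add: zero_less_divide_iff)
  qed
  show ?thesis
    unfolding pf_root_def using mem bound by (intro cSup_eq_maximum) auto
qed

text \<open>
  Where the ratio of two positive eigenvectors is minimal, the eigenvalue equation makes it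
  minimal at all successors as well, hence everywhere by strong connectivity.
\<close>

lemma positive_eigenvector_unique:
  assumes sc: "strongly_connected_digraph Y E" and F: "F \<in> pos_fun_space E"
    and v: "\<And>y. y \<in> Y \<Longrightarrow> 0 < v y"
    and eigv: "\<And>y. y \<in> Y \<Longrightarrow> (\<Sum>y'\<in>Y. F y y' * v y') = \<rho> * v y"
    and w: "\<And>y. y \<in> Y \<Longrightarrow> 0 < w y"
    and eigw: "\<And>y. y \<in> Y \<Longrightarrow> (\<Sum>y'\<in>Y. F y y' * w y') = \<rho> * w y"
  obtains t :: real where "0 < t" "\<And>y. y \<in> Y \<Longrightarrow> w y = t * v y"
proof -
  have fin: "finite Y" and sub: "E \<subseteq> Y \<times> Y" and ne: "Y \<noteq> {}"
    using sc by (auto simp: strongly_connected_digraph_def)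
  let ?r = "\<lambda>y. w y / v y"
  obtain z where z: "z \<in> Y" and min: "\<And>y. y \<in> Y \<Longrightarrow> ?r z \<le> ?r y"
    using ex_is_arg_min_if_finite[OF fin ne, of ?r] by (auto simp: is_arg_min_linorder)
  define t where "t = ?r z"
  have gap: "0 \<le> w y - t * v y" if "y \<in> Y" for y
    using min[OF that] v[OF that] by (simp add: t_def pos_le_divide_eq)
  have "Y \<subseteq> {y \<in> Y. w y = t * v y}"
  proof (rule strongly_connected_closed_subset[OF sc _ z])
    show "z \<in> {y \<in> Y. w y = t * v y}" using z v[OF z] by (simp add: t_def)
    fix y y' assume "y \<in> {y \<in> Y. w y = t * v y}" and e: "(y, y') \<in> E"
    then have y: "y \<in> Y" "w y = t * v y" and y': "y' \<in> Y" using sub by auto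
    have "(\<Sum>y'\<in>Y. F y y' * (w y' - t * v y'))
            = (\<Sum>y'\<in>Y. F y y' * w y') - t * (\<Sum>y'\<in>Y. F y y' * v y')"
      by (simp add: right_diff_distrib sum_subtractf sum_distrib_left mult_ac)
    also have "\<dots> = 0"
      using eigv[OF y(1)] eigw[OF y(1)] y(2) by simp
    finally have "F y y' * (w y' - t * v y') = 0"
      using fin y' gap pos_fun_space_nonneg[OF F]
      by (subst (asm) sum_nonneg_eq_0_iff) auto
    moreover have "0 < F y y'" using F e by (force simp: pos_fun_space_def)
    ultimately show "y' \<in> {y \<in> Y. w y = t * v y}" using y' by simp
  qed
  then show thesis
    using that[of t] v[OF z] w[OF z] by (auto simp: t_def)
qed

text \<open>This makes the rescaling computable from any positive eigenpair at hand.\<close>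

lemma stoch_rescale_eqI:
  assumes sc: "strongly_connected_digraph Y E" and F: "F \<in> pos_fun_space E"
    and v: "\<And>y. y \<in> Y \<Longrightarrow> 0 < v y"
    and eig: "\<And>y. y \<in> Y \<Longrightarrow> (\<Sum>y'\<in>Y. F y y' * v y') = \<rho> * v y"
  shows "stoch_rescale Y F = (\<lambda>y y'. F y y' * v y' / (\<rho> * v y))"
proof -
  have fin: "finite Y" and sub: "E \<subseteq> Y \<times> Y" and ne: "Y \<noteq> {}"
    using sc by (auto simp: strongly_connected_digraph_def)
  have root: "pf_root Y F = \<rho>"
    using pf_root_eqI[OF fin ne pos_fun_space_nonneg[OF F] v eig] by blast
  then have "is_pf_vector Y F v" using v eig by (simp add: is_pf_vector_def)
  then have "is_pf_vector Y F (pf_vector Y F)" unfolding pf_vector_def by (rule someI[of "is_pf_vector Y F"])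
  then obtain t where t: "0 < t" "\<And>y. y \<in> Y \<Longrightarrow> pf_vector Y F y = t * v y"
    using positive_eigenvector_unique[OF sc F v eig, of "pf_vector Y F"] root
    by (auto simp: is_pf_vector_def)
  show ?thesis
  proof (intro ext)
    fix y y'
    show "stoch_rescale Y F y y' = F y y' * v y' / (\<rho> * v y)"
    proof (cases "(y, y') \<in> E")
      case True
      then show ?thesis using sub t by (auto simp: stoch_rescale_def root)
    next
      case False
      then show ?thesis using F by (simp add: stoch_rescale_def pos_fun_space_def fun_space_def)
    qed
  qed
qed

text \<open>
  The conclusion of the Perron--Frobenius theorem; the positivity of \<open>v\<close> is what makes \<open>\<rho>\<close> the
  spectral radius.
\<close>

definition has_positive_eigenpair :: "'a set \<Rightarrow> 'a matrix \<Rightarrow> bool" where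
  "has_positive_eigenpair Y F \<longleftrightarrow>
     (\<exists>\<rho> v. 0 < \<rho> \<and> (\<forall>y\<in>Y. 0 < v y) \<and> (\<forall>y\<in>Y. (\<Sum>y'\<in>Y. F y y' * v y') = \<rho> * v y))"

lemma stoch_rescale_stochastic:
  assumes sc: "strongly_connected_digraph Y E" and F: "F \<in> pos_fun_space E"
    and pair: "has_positive_eigenpair Y F"
  shows "stoch_rescale Y F \<in> stochastic_matrices Y E"
proof -
  have sub: "E \<subseteq> Y \<times> Y"
    using sc by (simp add: strongly_connected_digraph_def)
  obtain \<rho> v where \<rho>: "0 < \<rho>" and v: "\<And>y. y \<in> Y \<Longrightarrow> 0 < v y"
    and eig: "\<And>y. y \<in> Y \<Longrightarrow> (\<Sum>y'\<in>Y. F y y' * v y') = \<rho> * v y"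
    using pair unfolding has_positive_eigenpair_def by blast
  have eq: "stoch_rescale Y F = (\<lambda>y y'. F y y' * v y' / (\<rho> * v y))"
    by (rule stoch_rescale_eqI[OF sc F v eig])
  have "(\<Sum>y'\<in>Y. F y y' * v y' / (\<rho> * v y)) = 1" if "y \<in> Y" for y
    using eig[OF that] v[OF that] \<rho> by (simp flip: sum_divide_distrib)
  moreover have "0 < F y y' * v y' / (\<rho> * v y)" if "(y, y') \<in> E" for y y'
  proof -
    have "0 < F y y'" using F that by (force simp: pos_fun_space_def)
    then show ?thesis using that sub v \<rho> by auto
  qed
  ultimately show ?thesis
    using F unfolding eq by (auto simp: stochastic_matrices_def pos_fun_space_def fun_space_def)
qed


section \<open>The set of all stochastic matrices as an e-family\<close>

text \<open>
  Take \<open>B\<close> maximal among the edge sets that support no nonzero member of the null space. By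
  maximality, each edge outside \<open>B\<close> carries a null function that vanishes at all other edges
  outside \<open>B\<close>; subtracting multiples of these clears a given function outside \<open>B\<close>.
\<close>

lemma null_space_coordinate_complement:
  assumes fin: "finite E"
  obtains B where "B \<subseteq> E" "null_space E \<inter> fun_space B \<subseteq> {\<lambda>y y'. 0}"
    "\<And>H. H \<in> fun_space E \<Longrightarrow> \<exists>N\<in>null_space E. (\<lambda>y y'. H y y' - N y y') \<in> fun_space B"
proof -
  let ?good = "\<lambda>B. B \<subseteq> E \<and> null_space E \<inter> fun_space B \<subseteq> {\<lambda>y y'. 0}"
  have "finite {B. ?good B}" using fin by simp
  moreover have "?good {}" by (auto simp: fun_space_def)
  ultimately have "\<exists>B\<in>{B. ?good B}. \<forall>C\<in>{B. ?good B}. B \<subseteq> C \<longrightarrow> B = C"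
    by (intro finite_has_maximal) auto
  then obtain B where B: "?good B" and max: "\<And>C. ?good C \<Longrightarrow> B \<subseteq> C \<Longrightarrow> C = B"
    by (metis (no_types, lifting) mem_Collect_eq)
  have "\<exists>M\<in>null_space E. M \<in> fun_space (insert e B) \<and> M (fst e) (snd e) \<noteq> 0"
    if e: "e \<in> E - B" for e
  proof -
    have "\<not> ?good (insert e B)" using max[of "insert e B"] e by blast
    then obtain M where M: "M \<in> null_space E" "M \<in> fun_space (insert e B)" "M \<noteq> (\<lambda>y y'. 0)"
      using B e by auto
    moreover have "M (fst e) (snd e) \<noteq> 0"
    proof
      assume 0: "M (fst e) (snd e) = 0"
      have "M y y' = 0" if "(y, y') \<notin> B" for y y'
        using M(2) that 0 by (cases "e = (y, y')") (auto simp: fun_space_def)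
      then have "M \<in> fun_space B" by (simp add: fun_space_def)
      then show False using B M by blast
    qed
    ultimately show ?thesis by blast
  qed
  then obtain M where M: "\<And>e. e \<in> E - B \<Longrightarrow> M e \<in> null_space E"
    "\<And>e. e \<in> E - B \<Longrightarrow> M e \<in> fun_space (insert e B)"
    "\<And>e. e \<in> E - B \<Longrightarrow> M e (fst e) (snd e) \<noteq> 0"
    by metis
  have "\<forall>e\<in>E-B. \<exists>f c. \<forall>(y, y')\<in>E. M e y y' = (f y' :: real) - f y + c"
    using M(1) unfolding null_space_def by blast
  then obtain f c where "\<forall>e\<in>E-B. \<forall>(y, y')\<in>E. M e y y' = f e y' - f e y + c e"
    unfolding bchoice_iff by blast
  then have fc: "M e y y' = f e y' - f e y + c e" if "e \<in> E - B" "(y, y') \<in> E" for e y y'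
    using that by fast
  show thesis
  proof (rule that[of B])
    fix H assume H: "H \<in> fun_space E"
    define a where "a e = H (fst e) (snd e) / M e (fst e) (snd e)" for e
    define N where "N y y' = (\<Sum>e\<in>E-B. a e * M e y y')" for y y'
    have "N \<in> null_space E"
    proof -
      have "N y y' = (\<Sum>e\<in>E-B. a e * f e y') - (\<Sum>e\<in>E-B. a e * f e y) + (\<Sum>e\<in>E-B. a e * c e)"
        if "(y, y') \<in> E" for y y'
      proof -
        have "N y y' = (\<Sum>e\<in>E-B. a e * (f e y' - f e y + c e))"
          unfolding N_def using fc[OF _ that] by (intro sum.cong) auto
        then show ?thesis by (simp add: distrib_left right_diff_distrib sum.distrib sum_subtractf)
      qed
      moreover have "N \<in> fun_space E"
        using M(1) by (auto simp: N_def fun_space_def null_space_def intro!: sum.neutral)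
      ultimately show ?thesis
        unfolding null_space_def
        by (intro CollectI conjI exI[of _ "\<lambda>y. \<Sum>e\<in>E-B. a e * f e y"]
            exI[of _ "\<Sum>e\<in>E-B. a e * c e"]) auto
    qed
    moreover have "(\<lambda>y y'. H y y' - N y y') \<in> fun_space B"
    proof -
      have "H y y' - N y y' = 0" if "(y, y') \<notin> B" for y y'
      proof (cases "(y, y') \<in> E")
        case True
        have "N y y' = (\<Sum>e\<in>E-B. if e = (y, y') then H y y' else 0)"
          unfolding N_def using M(2,3) that
          by (intro sum.cong) (auto simp: a_def fun_space_def)
        then show ?thesis using fin True that by simp
      next
        case False
        then show ?thesis using H \<open>N \<in> null_space E\<close> by (auto simp: fun_space_def null_space_def)
      qed
      then show ?thesis by (simp add: fun_space_def)
    qed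
    ultimately show "\<exists>N\<in>null_space E. (\<lambda>y y'. H y y' - N y y') \<in> fun_space B" by blast
  qed (use B in auto)
qed

text \<open>
  If \<open>N\<close> is given by \<open>f\<close> and \<open>c\<close>, dividing \<open>P\<close> by \<open>exp N\<close> conjugates it by the diagonal matrix
  \<open>exp f\<close> and scales it by \<open>exp (- c)\<close>. The constant eigenvector of \<open>P\<close> thereby becomes \<open>exp f\<close>, and
  the rescaling undoes both operations.
\<close>

lemma stoch_rescale_exp_log_minus_null:
  assumes sc: "strongly_connected_digraph Y E" and P: "P \<in> stochastic_matrices Y E"
    and N: "N \<in> null_space E"
  shows "stoch_rescale Y (exp_on E (\<lambda>y y'. ln (P y y') - N y y')) = P"
proof -
  let ?F = "exp_on E (\<lambda>y y'. ln (P y y') - N y y')"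
  obtain f c where fc: "\<And>y y'. (y, y') \<in> E \<Longrightarrow> N y y' = f y' - f y + c"
    using N unfolding null_space_def by blast
  have P0: "P y y' = 0" if "(y, y') \<notin> E" for y y'
    using P that by (simp add: stochastic_matrices_def pos_fun_space_def fun_space_def)
  have Ppos: "0 < P y y'" if "(y, y') \<in> E" for y y'
    using P that by (force simp: stochastic_matrices_def pos_fun_space_def)
  have F: "?F y y' * exp (f y') = P y y' * (exp (- c) * exp (f y))" for y y'
  proof (cases "(y, y') \<in> E")
    case True
    then have "?F y y' * exp (f y') = exp (ln (P y y')) * exp (f y - c)"
      by (simp add: exp_on_def fc flip: exp_add)
    then show ?thesis using Ppos[OF True] by (simp add: exp_diff exp_minus divide_inverse)
  qed (simp add: exp_on_def P0)
  have "stoch_rescale Y ?F = (\<lambda>y y'. ?F y y' * exp (f y') / (exp (- c) * exp (f y)))"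
  proof (rule stoch_rescale_eqI[OF sc])
    show "?F \<in> pos_fun_space E" by (auto simp: exp_on_def pos_fun_space_def fun_space_def)
    fix y assume "y \<in> Y"
    then have "(\<Sum>y'\<in>Y. P y y') = 1" using P by (simp add: stochastic_matrices_def)
    then show "(\<Sum>y'\<in>Y. ?F y y' * exp (f y')) = exp (- c) * exp (f y)"
      unfolding F by (simp flip: sum_distrib_right)
  qed simp
  then show ?thesis unfolding F by simp
qed

text \<open>
  Indicators of the edges in the complement \<open>B\<close> serve as generators: the coordinates of a member
  of \<open>fun_space B\<close> are its values on \<open>B\<close>.
\<close>

theorem stochastic_matrices_e_family:
  assumes sc: "strongly_connected_digraph Y E"
    and pf: "\<And>F. F \<in> pos_fun_space E \<Longrightarrow> has_positive_eigenpair Y F"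
  shows "forms_e_family Y E (stochastic_matrices Y E)"
proof -
  have "finite E"
    using sc by (auto simp: strongly_connected_digraph_def intro: finite_subset[of E "Y \<times> Y"])
  then obtain B where B: "B \<subseteq> E" "null_space E \<inter> fun_space B \<subseteq> {\<lambda>y y'. 0}"
    and compl: "\<And>H. H \<in> fun_space E \<Longrightarrow>
      \<exists>N\<in>null_space E. (\<lambda>y y'. H y y' - N y y') \<in> fun_space B"
    using null_space_coordinate_complement by blast
  obtain b where b: "bij_betw b {..<card B} B"
    using ex_bij_betw_nat_finite[OF finite_subset[OF B(1) \<open>finite E\<close>]]
    by (auto simp: lessThan_atLeast0)
  define G :: "nat \<Rightarrow> 'a matrix" where "G i y y' = of_bool ((y, y') = b i)" for i y y'
  have bB: "b i \<in> B" if "i < card B" for i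
    using b that by (auto simp: bij_betw_def)
  have sum0: "(\<Sum>i<card B. a i * G i y y') = 0" if "(y, y') \<notin> B" for a y y'
    using that bB by (intro sum.neutral) (auto simp: G_def)
  have sumb: "(\<Sum>i<card B. a i * G i (fst (b j)) (snd (b j))) = a j" if "j < card B" for a j
  proof -
    have "(\<Sum>i<card B. a i * G i (fst (b j)) (snd (b j))) = (\<Sum>i<card B. if i = j then a j else 0)"
      using b that by (intro sum.cong) (auto simp: G_def bij_betw_def inj_on_def)
    then show ?thesis using that by simp
  qed
  have indep: "indep_mod_null E (card B) G"
    unfolding indep_mod_null_def
  proof (intro allI impI)
    fix a :: "nat \<Rightarrow> real" and j
    assume "(\<lambda>y y'. \<Sum>i<card B. a i * G i y y') \<in> null_space E" and j: "j < card B"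
    moreover have "(\<lambda>y y'. \<Sum>i<card B. a i * G i y y') \<in> fun_space B"
      using sum0 by (simp add: fun_space_def)
    ultimately have "(\<lambda>y y'. \<Sum>i<card B. a i * G i y y') = (\<lambda>y y'. 0)" using B(2) by blast
    then show "a j = 0" using sumb[OF j, of a] by metis
  qed
  have span: "\<exists>a. H = (\<lambda>y y'. \<Sum>i<card B. a i * G i y y')" if H: "H \<in> fun_space B" for H
  proof (intro exI[of _ "\<lambda>i. H (fst (b i)) (snd (b i))"] ext)
    fix y y'
    show "H y y' = (\<Sum>i<card B. H (fst (b i)) (snd (b i)) * G i y y')"
    proof (cases "(y, y') \<in> B")
      case True
      then have "(y, y') \<in> b ` {..<card B}" using b by (simp add: bij_betw_def)
      then obtain j where "j < card B" "b j = (y, y')" by (metis imageE lessThan_iff)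
      then show ?thesis using sumb[of j "\<lambda>i. H (fst (b i)) (snd (b i))"] by simp
    next
      case False
      then show ?thesis using sum0 H by (simp add: fun_space_def)
    qed
  qed
  let ?s = "\<lambda>\<theta>. stoch_rescale Y (exp_on E (\<lambda>y y'. 0 + (\<Sum>i<card B. \<theta> i * G i y y')))"
  have "stochastic_matrices Y E = {?s \<theta> | \<theta>. True}"
  proof (intro equalityI subsetI)
    fix P assume P: "P \<in> stochastic_matrices Y E"
    then have "(\<lambda>y y'. ln (P y y')) \<in> fun_space E"
      by (simp add: stochastic_matrices_def pos_fun_space_def fun_space_def)
    then obtain N where N: "N \<in> null_space E" "(\<lambda>y y'. ln (P y y') - N y y') \<in> fun_space B"
      using compl by blast
    then obtain \<theta> where "(\<lambda>y y'. ln (P y y') - N y y') = (\<lambda>y y'. \<Sum>i<card B. \<theta> i * G i y y')"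
      using span by blast
    then have "P = ?s \<theta>"
      using stoch_rescale_exp_log_minus_null[OF sc P N(1)] by simp
    then show "P \<in> {?s \<theta> | \<theta>. True}" by blast
  next
    fix P assume "P \<in> {?s \<theta> | \<theta>. True}"
    then obtain \<theta> where "P = ?s \<theta>" by blast
    moreover have "exp_on E H \<in> pos_fun_space E" for H
      by (auto simp: exp_on_def pos_fun_space_def fun_space_def)
    ultimately show "P \<in> stochastic_matrices Y E"
      using stoch_rescale_stochastic[OF sc] pf by blast
  qed
  moreover have "G i \<in> fun_space E" if "i < card B" for i
    using bB[OF that] B(1) by (auto simp: G_def fun_space_def)
  moreover have "(\<lambda>y y'. 0) \<in> fun_space E" by (simp add: fun_space_def)
  ultimately have "e_family_of_dim Y E (card B) (stochastic_matrices Y E)"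
    unfolding e_family_of_dim_def using indep
    by (intro conjI bexI[of _ "\<lambda>y y'. 0"] exI[of _ G]) auto
  then show ?thesis unfolding forms_e_family_def by blast
qed

lemma e_family_nonempty:
  assumes "forms_e_family Y E V"
  shows "V \<noteq> {}"
  using assms unfolding forms_e_family_def e_family_of_dim_def by blast


section \<open>Digraphs whose quotient is a directed cycle\<close>

lemma lumpable_if_lumped_edges_single_valued:
  assumes sc: "strongly_connected_digraph Y E" and single: "single_valued (lumped_edges E \<kappa>)"
  shows "lumpable_matrices Y E \<kappa> = stochastic_matrices Y E"
proof -
  have fin: "finite Y"
    using sc by (auto simp: strongly_connected_digraph_def)
  have "(\<Sum>y'\<in>fiber Y \<kappa> x'. P y y') = 1"
    if P: "P \<in> stochastic_matrices Y E" and D: "(x, x') \<in> lumped_edges E \<kappa>" and y: "y \<in> fiber Y \<kappa> x"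
    for P x x' y
  proof -
    have "P y y' = 0" if "y' \<in> Y - fiber Y \<kappa> x'" for y'
    proof -
      have "(y, y') \<notin> E"
      proof
        assume "(y, y') \<in> E"
        then have "(x, \<kappa> y') \<in> lumped_edges E \<kappa>" using y by (auto simp: lumped_edges_def fiber_def)
        then have "\<kappa> y' = x'" using single D by (auto dest: single_valuedD)
        then show False using that by (simp add: fiber_def)
      qed
      then show ?thesis
        using P by (simp add: stochastic_matrices_def pos_fun_space_def fun_space_def)
    qed
    then have "(\<Sum>y'\<in>fiber Y \<kappa> x'. P y y') = (\<Sum>y'\<in>Y. P y y')"
      using fin by (intro sum.mono_neutral_left) (auto simp: fiber_def)
    then show ?thesis using P y by (simp add: stochastic_matrices_def fiber_def)
  qed
  then show ?thesis unfolding lumpable_matrices_def by fastforce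
qed

text \<open>The row sums of the \<open>j\<close>-th power of a matrix, that is, \<open>F\<^sup>j\<close> applied to the constant 1.\<close>

primrec walk_weight :: "'a set \<Rightarrow> 'a matrix \<Rightarrow> nat \<Rightarrow> 'a \<Rightarrow> real" where
  "walk_weight Y F 0 y = 1"
| "walk_weight Y F (Suc j) y = (\<Sum>y'\<in>Y. F y y' * walk_weight Y F j y')"

lemma walk_weight_pos:
  assumes sc: "strongly_connected_digraph Y E" and F: "F \<in> pos_fun_space E"
  shows "y \<in> Y \<Longrightarrow> 0 < walk_weight Y F j y"
proof (induction j arbitrary: y)
  case (Suc j)
  have fin: "finite Y" and sub: "E \<subseteq> Y \<times> Y"
    using sc by (auto simp: strongly_connected_digraph_def)
  obtain y' where e: "(y, y') \<in> E" using strongly_connected_out_edge[OF sc Suc.prems] .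
  then have "0 < F y y'" using F by (force simp: pos_fun_space_def)
  then have "0 < F y y' * walk_weight Y F j y'" using Suc.IH e sub by auto
  then show ?case
    using fin e sub Suc.IH pos_fun_space_nonneg[OF F]
    by (auto intro!: sum_pos2[of Y y'] mult_nonneg_nonneg intro: less_imp_le)
qed simp

text \<open>
  If every walk from the root first comes back after exactly \<open>m\<close> steps, then \<open>\<rho>\<^sup>m\<close> is the total
  weight of the walks that return, and the eigenvector at a vertex is the weight of the walks from
  there to the root, each step discounted by \<open>\<rho>\<close>. A vertex of level \<open>k\<close> is \<open>m - k\<close> steps
  away from the root, so the walks of that length from it are those that end at the root.
\<close>

lemma cyclic_layers_positive_eigenpair:
  fixes \<kappa> :: "'a \<Rightarrow> nat"
  assumes sc: "strongly_connected_digraph Y E" and F: "F \<in> pos_fun_space E"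
    and m: "0 < m"
    and level: "\<And>y. y \<in> Y \<Longrightarrow> \<kappa> y < m"
    and step: "\<And>y y'. (y, y') \<in> E \<Longrightarrow> \<kappa> y' = Suc (\<kappa> y) mod m"
    and root: "fiber Y \<kappa> 0 = {r}"
  shows "has_positive_eigenpair Y F"
proof -
  have sub: "E \<subseteq> Y \<times> Y" using sc by (simp add: strongly_connected_digraph_def)
  have r: "r \<in> Y" "\<kappa> r = 0" and r_unique: "\<And>y. y \<in> Y \<Longrightarrow> \<kappa> y = 0 \<Longrightarrow> y = r"
    using root by (auto simp: fiber_def)
  define \<rho> where "\<rho> = root m (walk_weight Y F m r)"
  define v where "v y = walk_weight Y F (m - \<kappa> y) y / \<rho> ^ (m - \<kappa> y)" for y
  have pos: "0 < \<rho>" and pow: "\<rho> ^ m = walk_weight Y F m r"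
    using walk_weight_pos[OF sc F r(1), of m] m
    by (auto simp: \<rho>_def intro!: real_root_pow_pos2)
  have v_root: "v r = 1"
    using pow walk_weight_pos[OF sc F r(1), of m] r(2) by (simp add: v_def)
  have v_succ: "v y' = walk_weight Y F (m - Suc (\<kappa> y)) y' / \<rho> ^ (m - Suc (\<kappa> y))"
    if e: "(y, y') \<in> E" for y y'
  proof (cases "Suc (\<kappa> y) < m")
    case True
    then show ?thesis using step[OF e] by (simp add: v_def)
  next
    (* Both sides are 1: the root is its own return point after 0 steps and after m steps. *)
    case False
    then have "Suc (\<kappa> y) = m" using level[of y] e sub by force
    moreover from this have "y' = r" using step[OF e] r_unique e sub by auto
    ultimately show ?thesis using v_root by simp
  qed
  have "(\<Sum>y'\<in>Y. F y y' * v y') = \<rho> * v y" if y: "y \<in> Y" for y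
  proof -
    have j: "m - \<kappa> y = Suc (m - Suc (\<kappa> y))" using level[OF y] by simp
    have "F y y' * v y' = F y y' * walk_weight Y F (m - Suc (\<kappa> y)) y' / \<rho> ^ (m - Suc (\<kappa> y))" for y'
    proof (cases "(y, y') \<in> E")
      case True
      then show ?thesis by (simp add: v_succ)
    next
      case False
      then show ?thesis using F by (simp add: pos_fun_space_def fun_space_def)
    qed
    then have "(\<Sum>y'\<in>Y. F y y' * v y')
        = (\<Sum>y'\<in>Y. F y y' * walk_weight Y F (m - Suc (\<kappa> y)) y') / \<rho> ^ (m - Suc (\<kappa> y))"
      by (simp add: sum_divide_distrib)
    also have "\<dots> = \<rho> * v y" using pos unfolding v_def j by simp
    finally show ?thesis .
  qed
  moreover have "0 < v y" if "y \<in> Y" for y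
    using walk_weight_pos[OF sc F that] pos by (simp add: v_def)
  ultimately show ?thesis using pos unfolding has_positive_eigenpair_def by blast
qed


section \<open>A cycle of layers with sizes 1, 2, ..., 2\<close>

definition layer :: "nat \<Rightarrow> nat" where
  "layer y = Suc y div 2"

definition layer_vertices :: "nat \<Rightarrow> nat set" where
  "layer_vertices n = {..2 * n + 2}"

text \<open>
  Layer 0 is the single vertex 0 and layer \<open>k > 0\<close> consists of \<open>2 * k - 1\<close> and \<open>2 * k\<close>. The last
  layer, \<open>n + 1\<close>, leads back to layer 0.
\<close>

definition layer_edges :: "nat \<Rightarrow> (nat \<times> nat) set" where
  "layer_edges n = {(y, y'). y \<in> layer_vertices n \<and> y' \<in> layer_vertices n \<and>
     layer y' = Suc (layer y) mod (n + 2)}"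

lemma layer_less: "y \<in> layer_vertices n \<Longrightarrow> layer y < n + 2"
  by (auto simp: layer_def layer_vertices_def)

lemma fiber_layer_0: "fiber (layer_vertices n) layer 0 = {0}"
  by (auto simp: fiber_def layer_def layer_vertices_def)

lemma fiber_layer:
  assumes "k \<le> n"
  shows "fiber (layer_vertices n) layer (Suc k) = {2 * k + 1, 2 * k + 2}"
  using assms by (auto simp: fiber_def layer_def layer_vertices_def)

lemma layer_image: "layer ` layer_vertices n = {..n + 1}"
proof (intro equalityI subsetI)
  fix k assume "k \<in> {..n + 1}"
  then have "2 * k \<in> layer_vertices n" "layer (2 * k) = k"
    by (auto simp: layer_def layer_vertices_def)
  then show "k \<in> layer ` layer_vertices n" by force
qed (use layer_less in force)

lemma layer_edgeI:
  assumes "y \<in> layer_vertices n" "y' \<in> layer_vertices n" "layer y' = Suc (layer y) mod (n + 2)"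
  shows "(y, y') \<in> layer_edges n"
  using assms by (simp add: layer_edges_def)

lemma layer_strongly_connected:
  "strongly_connected_digraph (layer_vertices n) (layer_edges n)"
proof -
  have zero: "0 \<in> layer_vertices n" "layer 0 = 0" by (auto simp: layer_vertices_def layer_def)
  have from0: "(0, y) \<in> (layer_edges n)\<^sup>*" if "y \<in> layer_vertices n" "layer y = k" for k y
    using that
  proof (induction k arbitrary: y)
    case 0
    then have "y = 0" using fiber_layer_0[of n] by (auto simp: fiber_def)
    then show ?case by simp
  next
    case (Suc k)
    then have k: "Suc k < n + 2" using layer_less by force
    then obtain z where z: "z \<in> layer_vertices n" "layer z = k"
      using layer_image[of n] by (metis Suc_lessD atMost_iff imageE less_Suc_eq_le add_2_eq_Suc' Suc_eq_plus1)
    then have "(z, y) \<in> layer_edges n" using Suc.prems k by (intro layer_edgeI) auto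
    then show ?case using Suc.IH[OF z] by simp
  qed
  have to0: "(y, 0) \<in> (layer_edges n)\<^sup>*" if "y \<in> layer_vertices n" "layer y + j = n + 1" for j y
    using that
  proof (induction j arbitrary: y)
    case 0
    then have "(y, 0) \<in> layer_edges n" using zero by (intro layer_edgeI) auto
    then show ?case by simp
  next
    case (Suc j)
    then have k: "Suc (layer y) < n + 2" by simp
    then obtain z where z: "z \<in> layer_vertices n" "layer z = Suc (layer y)"
      using layer_image[of n] by (metis atMost_iff imageE less_Suc_eq_le add_2_eq_Suc' Suc_eq_plus1)
    then have "(y, z) \<in> layer_edges n" using Suc.prems k by (intro layer_edgeI) auto
    then show ?case using Suc.IH[of z] Suc.prems z by simp
  qed
  have to0': "(y, 0) \<in> (layer_edges n)\<^sup>*" if y: "y \<in> layer_vertices n" for y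
  proof -
    have "layer y + (n + 1 - layer y) = n + 1" using layer_less[OF y] by simp
    then show ?thesis using to0 y by blast
  qed
  have "(0, 1) \<in> layer_edges n"
    by (intro layer_edgeI) (auto simp: layer_vertices_def layer_def)
  then have "layer_edges n \<noteq> {}" by blast
  moreover have "(y, y') \<in> (layer_edges n)\<^sup>*"
    if "y \<in> layer_vertices n" "y' \<in> layer_vertices n" for y y'
    using to0'[OF that(1)] from0[OF that(2) refl] by (rule rtrancl_trans)
  moreover have "layer_edges n \<subseteq> layer_vertices n \<times> layer_vertices n"
    by (auto simp: layer_edges_def)
  ultimately show ?thesis
    by (simp add: strongly_connected_digraph_def layer_vertices_def)
qed

lemma layer_lumped_edge:
  "(x, x') \<in> lumped_edges (layer_edges n) layer \<Longrightarrow> x' = Suc x mod (n + 2) \<and> x < n + 2"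
  using layer_less by (auto simp: lumped_edges_def layer_edges_def)

lemma layer_multi_row_merging_blocks:
  "{b. multi_row_merging_block (layer_vertices n) (layer_edges n) layer b}
     = (\<lambda>k. (Suc k, Suc (Suc k))) ` {..<n}"
proof (intro equalityI subsetI)
  fix b assume "b \<in> {b. multi_row_merging_block (layer_vertices n) (layer_edges n) layer b}"
  then obtain x x' y where b: "b = (x, x')" and D: "(x, x') \<in> lumped_edges (layer_edges n) layer"
    and merge: "1 < card {(z, y') \<in> layer_edges n. z = y \<and> y' \<in> fiber (layer_vertices n) layer x'}"
    and rows: "2 \<le> card (fiber (layer_vertices n) layer x)"
    by (cases b) (auto simp: multi_row_merging_block_def merging_block_def)
  have x': "x' = Suc x mod (n + 2)" "x < n + 2" using layer_lumped_edge[OF D] by auto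
  have "x \<noteq> 0" using rows fiber_layer_0[of n] by (cases "x = 0") auto
  moreover have "x' \<noteq> 0"
  proof
    assume "x' = 0"
    then have "{(z, y') \<in> layer_edges n. z = y \<and> y' \<in> fiber (layer_vertices n) layer x'} \<subseteq> {(y, 0)}"
      by (auto simp: fiber_layer_0)
    then have "card {(z, y') \<in> layer_edges n. z = y \<and> y' \<in> fiber (layer_vertices n) layer x'} \<le> card {(y, 0::nat)}"
      by (intro card_mono) auto
    then show False using merge by simp
  qed
  then have "x \<noteq> n + 1" using x' by auto
  ultimately have "x - 1 < n" "b = (Suc (x - 1), Suc (Suc (x - 1)))" using b x' by auto
  then show "b \<in> (\<lambda>k. (Suc k, Suc (Suc k))) ` {..<n}" by blast
next
  fix b assume "b \<in> (\<lambda>k. (Suc k, Suc (Suc k))) ` {..<n}"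
  then obtain k where k: "k < n" and b: "b = (Suc k, Suc (Suc k))" by blast
  let ?y = "2 * k + 1"
  let ?S = "{(z, y') \<in> layer_edges n. z = ?y \<and> y' \<in> fiber (layer_vertices n) layer (Suc (Suc k))}"
  have fib: "fiber (layer_vertices n) layer (Suc k) = {2 * k + 1, 2 * k + 2}"
    "fiber (layer_vertices n) layer (Suc (Suc k)) = {2 * k + 3, 2 * k + 4}"
    using k fiber_layer[of k n] fiber_layer[of "Suc k" n] by (simp_all add: eval_nat_numeral)
  have e: "(?y, 2 * k + 3) \<in> layer_edges n" "(?y, 2 * k + 4) \<in> layer_edges n"
    using k by (auto intro!: layer_edgeI simp: layer_vertices_def layer_def)
  have S: "?S = {(?y, 2 * k + 3), (?y, 2 * k + 4)}"
    using e unfolding fib by auto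
  have "(layer ?y, layer (2 * k + 3)) \<in> lumped_edges (layer_edges n) layer"
    using e(1) unfolding lumped_edges_def by blast
  moreover have "layer ?y = Suc k" "layer (2 * k + 3) = Suc (Suc k)" by (auto simp: layer_def)
  moreover have "1 < card ?S" unfolding S by simp
  moreover have "?y \<in> fiber (layer_vertices n) layer (Suc k)" unfolding fib by simp
  ultimately have "merging_block (layer_vertices n) (layer_edges n) layer b"
    unfolding b merging_block_def by auto
  then show "b \<in> {b. multi_row_merging_block (layer_vertices n) (layer_edges n) layer b}"
    unfolding multi_row_merging_block_def b by (simp add: fib)
qed

theorem corollary4p2:
  fixes n :: nat
  shows "\<exists>(Y :: nat set) (X :: nat set) (E :: (nat \<times> nat) set) (\<kappa> :: nat \<Rightarrow> nat).
    finite Y \<and> finite X \<and>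
    strongly_connected_digraph Y E \<and>
    \<kappa> ` Y = X \<and> 1 < card X \<and> card X < card Y \<and>
    lumpable_matrices Y E \<kappa> \<noteq> {} \<and>
    forms_e_family Y E (lumpable_matrices Y E \<kappa>) \<and>
    card {b. multi_row_merging_block Y E \<kappa> b} = n"
proof -
  let ?Y = "layer_vertices n" and ?E = "layer_edges n"
  have sc: "strongly_connected_digraph ?Y ?E" by (rule layer_strongly_connected)
  have "single_valued (lumped_edges ?E layer)"
    using layer_lumped_edge by (metis single_valuedI)
  then have lumpable: "lumpable_matrices ?Y ?E layer = stochastic_matrices ?Y ?E"
    by (rule lumpable_if_lumped_edges_single_valued[OF sc])
  have "has_positive_eigenpair ?Y F" if "F \<in> pos_fun_space ?E" for F
    using cyclic_layers_positive_eigenpair[OF sc that _ layer_less _ fiber_layer_0]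
    by (auto simp: layer_edges_def)
  then have fam: "forms_e_family ?Y ?E (lumpable_matrices ?Y ?E layer)"
    unfolding lumpable by (rule stochastic_matrices_e_family[OF sc])
  have "card {b. multi_row_merging_block ?Y ?E layer b} = n"
    unfolding layer_multi_row_merging_blocks by (subst card_image) (auto simp: inj_on_def)
  moreover have "finite ?Y" "card ?Y = 2 * n + 3" by (auto simp: layer_vertices_def)
  ultimately show ?thesis
    using sc fam e_family_nonempty[OF fam] layer_image[of n]
    by (intro exI[of _ ?Y] exI[of _ "{..n + 1}"] exI[of _ ?E] exI[of _ layer]) auto
qed

end
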